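(* Let $\mathcal{P}_i$ be a path with $|\mathcal{P}_i|$ links $\mathcal{P}_{i,1},\ldots,\mathcal{P}_{i,|\mathcal{P}_i|}$, with binary-valued link failure (data corruption) indicator processes $\{l_{\mathcal{P}_i}^{\mathcal{P}_{i,j}}(t)\in\{0,1\}\}_{t\in\mathbb{N}_0}$, $j\in\{1,\ldots,|\mathcal{P}_i|\}$ (not assumed to be mutually independent), and let $$l_{\mathcal{P}_i}(t)=l_{\mathcal{P}_i}^{\mathcal{P}_{i,1}}(t)\vee l_{\mathcal{P}_i}^{\mathcal{P}_{i,2}}(t)\vee\cdots\vee l_{\mathcal{P}_i}^{\mathcal{P}_{i,|\mathcal{P}_i|}}(t),\quad t\in\mathbb{N}_0.$$ Assume $l_{\mathcal{P}_i}^{\mathcal{P}_{i,j}}\in\Lambda_{\rho_{\mathcal{P}_i}^{\mathcal{P}_{i,j}}}$, $j\in\{1,\ldots,|\mathcal{P}_i|\}$, where the scalars $\rho_{\mathcal{P}_i}^{\mathcal{P}_{i,j}}\in[0,1]$ satisfy $\sum_{j=1}^{|\mathcal{P}_i|}\rho_{\mathcal{P}_i}^{\mathcal{P}_{i,j}}\le 1$. Then $l_{\mathcal{P}_i}\in\Lambda_{\rho_{\mathcal{P}_i}}$ with $\rho_{\mathcal{P}_i}\triangleq\sum_{j=1}^{|\mathcal{P}_i|}\rho_{\mathcal{P}_i}^{\mathcal{P}_{i,j}}$.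
   Context: All processes are defined on a common probability space $(\Omega,\mathcal{F},\mathbb{P})$. $\vee$ denotes the or-operation on binary numbers. Class $\Lambda_\rho$: for $\rho\in[0,1]$, $\Lambda_\rho$ is the class of binary-valued processes $l=\{l(t)\in\{0,1\}\}_{t\in\mathbb{N}_0}$ such that $\sum_{k=1}^{\infty}\mathbb{P}[\sum_{t=0}^{k-1}l(t)>\rho k]<\infty$. Interpretation: $l_{\mathcal{P}_i}^{\mathcal{P}_{i,j}}(t)=1$ means that the packet of time $t$ flowing on path $\mathcal{P}_i$ is corrupted on the $j$th link of that path; $l_{\mathcal{P}_i}(t)=1$ means that it is corrupted on at least one link of the path. *)

theory Defs
  imports "HOL-Probability.Probability"
begin

text \<open>
  A binary-valued process is a sequence of measurable maps into \<open>count_space {0, 1}\<close>; this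
  carries both measurability and the constraint that every value on \<open>space M\<close> is 0 or 1.
  The series over \<open>k \<ge> 1\<close> is indexed by \<open>Suc k\<close>; its terms are nonnegative, so
  summability is finiteness of the sum.
\<close>

definition Lambda_class :: "'a measure \<Rightarrow> real \<Rightarrow> (nat \<Rightarrow> 'a \<Rightarrow> nat) set" where
  "Lambda_class M \<rho> =
    {l. (\<forall>t. l t \<in> M \<rightarrow>\<^sub>M count_space {0, 1}) \<and>
        summable (\<lambda>k. measure M {\<omega> \<in> space M. real (\<Sum>t<Suc k. l t \<omega>) > \<rho> * real (Suc k)})}"

text \<open>
  \<open>iterated_or x n\<close> is \<open>x 1 \<or> x 2 \<or> \<dots> \<or> x n\<close> for binary numbers, with the empty disjunction
  equal to 0.
\<close>

primrec iterated_or :: "(nat \<Rightarrow> nat) \<Rightarrow> nat \<Rightarrow> nat" where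
  "iterated_or x 0 = 0"
| "iterated_or x (Suc n) = Bit_Operations.or (iterated_or x n) (x (Suc n))"

definition path_failure :: "nat \<Rightarrow> (nat \<Rightarrow> nat \<Rightarrow> 'a \<Rightarrow> nat) \<Rightarrow> nat \<Rightarrow> 'a \<Rightarrow> nat" where
  "path_failure n l t \<omega> = iterated_or (\<lambda>j. l j t \<omega>) n"

end

theory Submission
  imports Defs
begin

text \<open>
  On binary values the or-operation is dominated by addition.  If the partial sum of the
  disjunction of two processes exceeds \<open>(\<rho> + \<rho>') k\<close>, then one of the two partial sums exceeds
  \<open>\<rho> k\<close> or \<open>\<rho>' k\<close>, so the tail series of the disjunction is dominated by the sum of the
  tail series of the two processes.  Induction on the number of links does the rest.
\<close>

text \<open>Closure keeps the disjunction binary-valued, the additive bound compares partial sums,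
  and the zero test identifies the preimage of 0.\<close>

lemma or_binary:
  fixes x y :: nat
  assumes "x \<in> {0, 1}" "y \<in> {0, 1}"
  shows "Bit_Operations.or x y \<in> {0, 1}" "Bit_Operations.or x y \<le> x + y"
    "Bit_Operations.or x y = 0 \<longleftrightarrow> x = 0 \<and> y = 0"
  using assms by auto

lemma measurable_or_binary:
  fixes f g :: "'a \<Rightarrow> nat"
  assumes f: "f \<in> M \<rightarrow>\<^sub>M count_space {0, 1}" and g: "g \<in> M \<rightarrow>\<^sub>M count_space {0, 1}"
  shows "(\<lambda>\<omega>. Bit_Operations.or (f \<omega>) (g \<omega>)) \<in> M \<rightarrow>\<^sub>M count_space {0, 1}"
proof -
  have bin: "f \<omega> \<in> {0, 1}" "g \<omega> \<in> {0, 1}" if "\<omega> \<in> space M" for \<omega>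
    using measurable_space[OF f that] measurable_space[OF g that] by simp_all
  have pre: "f -` {a} \<inter> space M \<in> sets M" "g -` {a} \<inter> space M \<in> sets M"
    if "a \<in> {0, 1}" for a
    using measurable_sets[OF f, of "{a}"] measurable_sets[OF g, of "{a}"] that by auto
  let ?h = "\<lambda>\<omega>. Bit_Operations.or (f \<omega>) (g \<omega>)"
  \<comment> \<open>The target is finite and discrete, so measurability reduces to the preimages of
    its two points.\<close>
  have "?h -` {0} \<inter> space M = (f -` {0} \<inter> space M) \<inter> (g -` {0} \<inter> space M)"
    using bin or_binary(3) by auto
  moreover have "?h -` {1} \<inter> space M = (f -` {1} \<inter> space M) \<union> (g -` {1} \<inter> space M)"
    using bin by fastforce
  ultimately have "?h -` {a} \<inter> space M \<in> sets M" if "a \<in> {0, 1}" for a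
    using that pre by auto
  then show ?thesis
    using bin or_binary(1) by (subst measurable_count_space_eq2) auto
qed

lemma sets_partial_sum_gt:
  fixes l :: "nat \<Rightarrow> 'a \<Rightarrow> nat"
  assumes "\<And>t. l t \<in> M \<rightarrow>\<^sub>M count_space {0, 1}"
  shows "{\<omega> \<in> space M. real (\<Sum>t<k. l t \<omega>) > c} \<in> sets M"
proof -
  \<comment> \<open>Every function on a count space is measurable, so composing with
    \<open>real\<close> moves the process into the Borel setting, where sums and strict comparisons
    are measurable.\<close>
  have [measurable]: "(\<lambda>\<omega>. real (l t \<omega>)) \<in> borel_measurable M" for t
    by (rule measurable_compose[OF assms]) simp
  show ?thesis
    unfolding of_nat_sum by measurable
qed

text \<open>Base case, the empty disjunction: at rate 0 each event demands \<open>0 > 0\<close>, so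
  every term of the series vanishes.\<close>

lemma Lambda_class_zero: "(\<lambda>t \<omega>. 0) \<in> Lambda_class M 0"
  by (simp add: Lambda_class_def)

lemma Lambda_class_or:
  assumes "finite_measure M" and l: "l \<in> Lambda_class M \<rho>" and l': "l' \<in> Lambda_class M \<rho>'"
  shows "(\<lambda>t \<omega>. Bit_Operations.or (l t \<omega>) (l' t \<omega>)) \<in> Lambda_class M (\<rho> + \<rho>')"
proof -
  interpret finite_measure M by fact
  define E where "E f r k = {\<omega> \<in> space M. real (\<Sum>t<Suc k. f t \<omega>) > r * real (Suc k)}"
    for f :: "nat \<Rightarrow> 'a \<Rightarrow> nat" and r k
  let ?h = "\<lambda>t \<omega>. Bit_Operations.or (l t \<omega>) (l' t \<omega>)"
  have meas: "l t \<in> M \<rightarrow>\<^sub>M count_space {0, 1}" "l' t \<in> M \<rightarrow>\<^sub>M count_space {0, 1}" for t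
    using l l' by (auto simp: Lambda_class_def)
  have summ: "summable (\<lambda>k. measure M (E l \<rho> k))" "summable (\<lambda>k. measure M (E l' \<rho>' k))"
    using l l' by (auto simp: Lambda_class_def E_def)
  have sets: "E l \<rho> k \<in> sets M" "E l' \<rho>' k \<in> sets M" for k
    unfolding E_def by (intro sets_partial_sum_gt meas)+
  have sub: "E ?h (\<rho> + \<rho>') k \<subseteq> E l \<rho> k \<union> E l' \<rho>' k" for k
  proof
    fix \<omega> assume \<omega>: "\<omega> \<in> E ?h (\<rho> + \<rho>') k"
    then have "\<omega> \<in> space M" by (simp add: E_def)
    then have "?h t \<omega> \<le> l t \<omega> + l' t \<omega>" for t
      using measurable_space[OF meas(1)] measurable_space[OF meas(2)]
      by (intro or_binary(2)) simp_all
    then have "(\<Sum>t<Suc k. ?h t \<omega>) \<le> (\<Sum>t<Suc k. l t \<omega>) + (\<Sum>t<Suc k. l' t \<omega>)"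
      unfolding sum.distrib[symmetric] by (intro sum_mono)
    then have "real (\<Sum>t<Suc k. ?h t \<omega>) \<le> real (\<Sum>t<Suc k. l t \<omega>) + real (\<Sum>t<Suc k. l' t \<omega>)"
      unfolding of_nat_add[symmetric] of_nat_le_iff .
    moreover have "(\<rho> + \<rho>') * real (Suc k) < real (\<Sum>t<Suc k. ?h t \<omega>)"
      using \<omega> by (simp only: E_def mem_Collect_eq)
    \<comment> \<open>Outside both events the two sums are at most
      \<open>\<rho> * real (Suc k)\<close> and \<open>\<rho>' * real (Suc k)\<close>; adding these
      contradicts the strict excess.\<close>
    ultimately show "\<omega> \<in> E l \<rho> k \<union> E l' \<rho>' k"
      using \<open>\<omega> \<in> space M\<close> unfolding E_def Un_iff mem_Collect_eq distrib_right by linarith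
  qed
  \<comment> \<open>Monotonicity into the measurable union, then subadditivity: a union bound, valid
    under any dependence between the processes.\<close>
  have "measure M (E ?h (\<rho> + \<rho>') k) \<le> measure M (E l \<rho> k) + measure M (E l' \<rho>' k)" for k
    using finite_measure_mono[OF sub] measure_Un_le[OF sets] sets
    by (meson order_trans sets.Un)
  then have "summable (\<lambda>k. measure M (E ?h (\<rho> + \<rho>') k))"
    by (intro summable_comparison_test'[OF summable_add[OF summ], of 0]) simp
  then show ?thesis
    using measurable_or_binary[OF meas] by (simp add: Lambda_class_def E_def)
qed

theorem proposition4p1:
  fixes M :: "'a measure"
    and n :: nat
    and l :: "nat \<Rightarrow> nat \<Rightarrow> 'a \<Rightarrow> nat"
    and \<rho> :: "nat \<Rightarrow> real"
  assumes "prob_space M"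
    and "\<And>j. j \<in> {1..n} \<Longrightarrow> \<rho> j \<in> {0..1}"
    and "\<And>j. j \<in> {1..n} \<Longrightarrow> l j \<in> Lambda_class M (\<rho> j)"
    and "(\<Sum>j=1..n. \<rho> j) \<le> 1"
  shows "path_failure n l \<in> Lambda_class M (\<Sum>j=1..n. \<rho> j)"
  \<comment> \<open>Membership of the links depends on \<open>n\<close>, so it is chained into the
    induction and can be restricted to the first \<open>n\<close> links.\<close>
  using assms(3)
proof (induction n)
  case 0
  have "path_failure 0 l = (\<lambda>t \<omega>. 0)"
    by (simp add: path_failure_def fun_eq_iff)
  then show ?case
    using Lambda_class_zero by simp
next
  case (Suc n)
  \<comment> \<open>The last link is split off, as in the recursion of \<open>iterated_or\<close>;
    its rate is the top term of the sum.\<close>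
  have "path_failure (Suc n) l =
      (\<lambda>t \<omega>. Bit_Operations.or (path_failure n l t \<omega>) (l (Suc n) t \<omega>))"
    by (simp add: path_failure_def fun_eq_iff)
  moreover have "path_failure n l \<in> Lambda_class M (\<Sum>j=1..n. \<rho> j)"
    using Suc.prems by (intro Suc.IH) auto
  ultimately show ?case
    using Suc.prems[of "Suc n"] Lambda_class_or[OF prob_space.axioms(1)[OF assms(1)]] by simp
qed

end
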